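(* Let $(A,\mu,\Delta,\alpha,r)$ be a coboundary $\epsilon$-Hom-bialgebra. Then for each integer $n\ge 0$, $$A^n=(A,\mu^{(n)},\Delta^{(n)},\alpha^{2^n},r)$$ is also a coboundary $\epsilon$-Hom-bialgebra, where $\mu^{(n)}=\alpha^{2^n-1}\circ\mu$ and $\Delta^{(n)}=\Delta\circ\alpha^{2^n-1}$.
   Context: Throughout, $\mathbf{k}$ is a fixed field of characteristic $0$; vector spaces, linear maps and tensor products are over $\mathbf{k}$. For a linear self-map $f$, $f^m$ denotes its $m$-fold composition, with $f^0=Id$. An $\epsilon$-Hom-bialgebra $(A,\mu,\Delta,\alpha)$ is a $\mathbf{k}$-vector space $A$ with linear maps $\mu\colon A^{\otimes 2}\to A$, $\Delta\colon A\to A^{\otimes 2}$, $\alpha\colon A\to A$ such that: $\alpha\circ\mu=\mu\circ\alpha^{\otimes 2}$; $\mu\circ(\alpha\otimes\mu)=\mu\circ(\mu\otimes\alpha)$; $\alpha^{\otimes 2}\circ\Delta=\Delta\circ\alpha$; $(\alpha\otimes\Delta)\circ\Delta=(\Delta\otimes\alpha)\circ\Delta$; and $\Delta\circ\mu=(\mu\otimes\alpha)\circ(\alpha\otimes\Delta)+(\alpha\otimes\mu)\circ(\Delta\otimes\alpha)$. For $a\in A$ and $r=\sum u_i\otimes v_i\in A^{\otimes 2}$, set (relative to $\mu$ and $\alpha$) $$[a,r]_*=\sum\mu(a,u_i)\otimes\alpha(v_i)-\alpha(u_i)\otimes\mu(v_i,a).$$ An element of $A^{\otimes 2}$ is $\alpha$-invariant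 if it is fixed by $\alpha^{\otimes 2}$. A coboundary $\epsilon$-Hom-bialgebra $(A,\mu,\Delta,\alpha,r)$ is an $\epsilon$-Hom-bialgebra $(A,\mu,\Delta,\alpha)$ together with an $\alpha$-invariant $r\in A^{\otimes 2}$ such that $\Delta=[-,r]_*$ (where $[-,r]_*$ is formed with the multiplication and twisting map of that $\epsilon$-Hom-bialgebra). *)

theory Defs
  imports Complex_Main "HOL-Library.Poly_Mapping"
begin

text \<open>
  Tensor products of vector spaces. Since the scalar multiplication of a vector space is a
  term and not part of its type, the tensor product is specified up to canonical isomorphism:
  a vector space \<open>T\<close> with a map \<open>\<otimes> : A \<times> B \<rightarrow> T\<close> is a tensor product of
  \<open>A\<close> and \<open>B\<close> if the induced map from the free vector space on \<open>A \<times> B\<close> to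
  \<open>T\<close> is onto and its kernel is the subspace spanned by the bilinearity relations, i.e.
  if \<open>T\<close> is the usual quotient. The universal property is derived below.
\<close>

definition free_scale :: "'k::field \<Rightarrow> ('x \<Rightarrow>\<^sub>0 'k) \<Rightarrow> ('x \<Rightarrow>\<^sub>0 'k)" where
  "free_scale c p = Poly_Mapping.map ((*) c) p"

definition free_extend ::
    "('k::field \<Rightarrow> 't::ab_group_add \<Rightarrow> 't) \<Rightarrow> ('x \<Rightarrow> 't) \<Rightarrow> ('x \<Rightarrow>\<^sub>0 'k) \<Rightarrow> 't" where
  "free_extend sT f p = (\<Sum>x\<in>Poly_Mapping.keys p. sT (Poly_Mapping.lookup p x) (f x))"

definition bilinear_relations ::
    "('k::field \<Rightarrow> 'a::ab_group_add \<Rightarrow> 'a) \<Rightarrow> ('k \<Rightarrow> 'b::ab_group_add \<Rightarrow> 'b) \<Rightarrow>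
     (('a \<times> 'b) \<Rightarrow>\<^sub>0 'k) set" where
  "bilinear_relations sA sB =
     {Poly_Mapping.single (x + x', y) 1 - Poly_Mapping.single (x, y) 1
        - Poly_Mapping.single (x', y) 1 | x x' y. True} \<union>
     {Poly_Mapping.single (x, y + y') 1 - Poly_Mapping.single (x, y) 1
        - Poly_Mapping.single (x, y') 1 | x y y'. True} \<union>
     {Poly_Mapping.single (sA c x, y) 1
        - free_scale c (Poly_Mapping.single (x, y) 1) | c x y. True} \<union>
     {Poly_Mapping.single (x, sB c y) 1
        - free_scale c (Poly_Mapping.single (x, y) 1) | c x y. True}"

locale tensor_product =
  A: vector_space sA + B: vector_space sB + T: vector_space sT
  for sA :: "'k::field \<Rightarrow> 'a::ab_group_add \<Rightarrow> 'a"
    and sB :: "'k \<Rightarrow> 'b::ab_group_add \<Rightarrow> 'b"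
    and sT :: "'k \<Rightarrow> 't::ab_group_add \<Rightarrow> 't" +
  fixes tens :: "'a \<Rightarrow> 'b \<Rightarrow> 't"
  assumes onto: "surj (free_extend sT (\<lambda>(x, y). tens x y))"
    and kernel: "{p. free_extend sT (\<lambda>(x, y). tens x y) p = 0}
                   = module.span free_scale (bilinear_relations sA sB)"

text \<open>
  The map \<open>f \<otimes> g : A \<otimes> B \<rightarrow> A' \<otimes> B'\<close> for linear \<open>f\<close> and \<open>g\<close>; by the lemma
  \<open>tensor_map\<close> below it is the unique linear map with
  \<open>(f \<otimes> g) (x \<otimes> y) = f x \<otimes> g y\<close>. (For nonlinear arguments the value is meaningless.)
\<close>

definition tensor_map ::
    "('k::field \<Rightarrow> 't::ab_group_add \<Rightarrow> 't) \<Rightarrow> ('a \<Rightarrow> 'b \<Rightarrow> 't) \<Rightarrow>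
     ('k \<Rightarrow> 'u::ab_group_add \<Rightarrow> 'u) \<Rightarrow> ('c \<Rightarrow> 'd \<Rightarrow> 'u) \<Rightarrow>
     ('a \<Rightarrow> 'c) \<Rightarrow> ('b \<Rightarrow> 'd) \<Rightarrow> 't \<Rightarrow> 'u" where
  "tensor_map sT tens sU tens' f g =
     (THE h. Vector_Spaces.linear sT sU h \<and> (\<forall>x y. h (tens x y) = tens' (f x) (g y)))"

lemma lookup_free_scale [simp]:
  "Poly_Mapping.lookup (free_scale c p) x = c * Poly_Mapping.lookup p x"
  by (auto simp: free_scale_def Poly_Mapping.map.rep_eq when_def)

lemma vector_space_free: "vector_space (free_scale :: 'k::field \<Rightarrow> ('x \<Rightarrow>\<^sub>0 'k) \<Rightarrow> _)"
  by unfold_locales (auto intro!: poly_mapping_eqI simp: lookup_add algebra_simps)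

context vector_space
begin

lemma free_extend_superset:
  assumes "finite S" "Poly_Mapping.keys p \<subseteq> S"
  shows "free_extend scale f p = (\<Sum>x\<in>S. scale (Poly_Mapping.lookup p x) (f x))"
  unfolding free_extend_def
  by (rule sum.mono_neutral_left) (use assms in \<open>auto simp: in_keys_iff\<close>)

lemma free_extend_single [simp]:
  "free_extend scale f (Poly_Mapping.single x c) = scale c (f x)"
  by (subst free_extend_superset[of "{x}"]) auto

lemma linear_free_extend: "Vector_Spaces.linear free_scale scale (free_extend scale f)"
proof -
  interpret F: vector_space "free_scale :: 'a \<Rightarrow> ('c \<Rightarrow>\<^sub>0 'a) \<Rightarrow> _"
    by (rule vector_space_free)
  show ?thesis
  proof unfold_locales
    fix p q :: "'c \<Rightarrow>\<^sub>0 'a"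
    let ?S = "Poly_Mapping.keys p \<union> Poly_Mapping.keys q"
    have "Poly_Mapping.keys (p + q) \<subseteq> ?S" by (rule Poly_Mapping.keys_add)
    then show "free_extend scale f (p + q) = free_extend scale f p + free_extend scale f q"
      by (simp add: free_extend_superset[of ?S] lookup_add scale_left_distrib sum.distrib)
  next
    fix c and p :: "'c \<Rightarrow>\<^sub>0 'a"
    have "Poly_Mapping.keys (free_scale c p) \<subseteq> Poly_Mapping.keys p"
      by (auto simp: in_keys_iff)
    then show "free_extend scale f (free_scale c p) = scale c (free_extend scale f p)"
      by (simp add: free_extend_superset[of "Poly_Mapping.keys p"] scale_sum_right)
  qed
qed

end

context tensor_product
begin

abbreviation "proj \<equiv> free_extend sT (\<lambda>(x, y). tens x y)"

lemma proj_relation: "p \<in> bilinear_relations sA sB \<Longrightarrow> proj p = 0"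
proof -
  interpret F: vector_space "free_scale :: 'k \<Rightarrow> (('a \<times> 'b) \<Rightarrow>\<^sub>0 'k) \<Rightarrow> _"
    by (rule vector_space_free)
  assume "p \<in> bilinear_relations sA sB"
  then have "p \<in> module.span free_scale (bilinear_relations sA sB)" by (rule F.span_base)
  then show ?thesis using kernel by blast
qed

lemma bilinear:
  "tens (x + x') y = tens x y + tens x' y"
  "tens x (y + y') = tens x y + tens x y'"
  "tens (sA c x) y = sT c (tens x y)"
  "tens x (sB c y) = sT c (tens x y)"
proof -
  interpret P: Vector_Spaces.linear free_scale sT proj by (rule T.linear_free_extend)
  have "proj (Poly_Mapping.single (x + x', y) 1 - Poly_Mapping.single (x, y) 1
          - Poly_Mapping.single (x', y) 1) = 0"
    by (rule proj_relation) (unfold bilinear_relations_def, blast)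
  then show "tens (x + x') y = tens x y + tens x' y"
    by (simp add: P.diff P.add diff_diff_eq)
  have "proj (Poly_Mapping.single (x, y + y') 1 - Poly_Mapping.single (x, y) 1
          - Poly_Mapping.single (x, y') 1) = 0"
    by (rule proj_relation) (unfold bilinear_relations_def, blast)
  then show "tens x (y + y') = tens x y + tens x y'"
    by (simp add: P.diff P.add diff_diff_eq)
  have "proj (Poly_Mapping.single (sA c x, y) 1
          - free_scale c (Poly_Mapping.single (x, y) 1)) = 0"
    by (rule proj_relation) (unfold bilinear_relations_def, blast)
  then show "tens (sA c x) y = sT c (tens x y)"
    by (simp add: P.diff P.scale)
  have "proj (Poly_Mapping.single (x, sB c y) 1
          - free_scale c (Poly_Mapping.single (x, y) 1)) = 0"
    by (rule proj_relation) (unfold bilinear_relations_def, blast)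
  then show "tens x (sB c y) = sT c (tens x y)"
    by (simp add: P.diff P.scale)
qed

lemma span_tens: "module.span sT {tens x y | x y. True} = UNIV"
proof -
  have "z \<in> module.span sT {tens x y | x y. True}" for z
  proof -
    obtain p where "z = proj p" using onto by (metis surjD)
    then show ?thesis
      by (auto simp: free_extend_def intro!: T.span_sum T.span_scale intro: T.span_base)
  qed
  then show ?thesis by blast
qed

lemma linear_unique:
  assumes g: "Vector_Spaces.linear sT sW g" and h: "Vector_Spaces.linear sT sW h"
    and eq: "\<And>x y. g (tens x y) = h (tens x y)"
  shows "g = h"
proof
  fix z
  interpret W: vector_space sW using g by (simp add: Vector_Spaces.linear_def)
  interpret vector_space_pair sT sW ..
  show "g z = h z"
    by (rule linear_eq_on[OF g h, where B = "{tens x y | x y. True}"])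
       (use eq span_tens in auto)
qed

lemma universal_property:
  fixes sW :: "'k \<Rightarrow> 'w::ab_group_add \<Rightarrow> 'w"
  assumes "vector_space sW"
    and add1: "\<And>x x' y. f (x + x') y = f x y + f x' y"
    and add2: "\<And>x y y'. f x (y + y') = f x y + f x y'"
    and scale1: "\<And>c x y. f (sA c x) y = sW c (f x y)"
    and scale2: "\<And>c x y. f x (sB c y) = sW c (f x y)"
  shows "\<exists>!h. Vector_Spaces.linear sT sW h \<and> (\<forall>x y. h (tens x y) = f x y)"
proof -
  interpret W: vector_space sW by fact
  interpret F: vector_space "free_scale :: 'k \<Rightarrow> (('a \<times> 'b) \<Rightarrow>\<^sub>0 'k) \<Rightarrow> _"
    by (rule vector_space_free)
  interpret P: Vector_Spaces.linear free_scale sT proj by (rule T.linear_free_extend)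
  define F where "F = free_extend sW (\<lambda>(x, y). f x y)"
  interpret FW: Vector_Spaces.linear free_scale sW F
    unfolding F_def by (rule W.linear_free_extend)
  have F_single: "F (Poly_Mapping.single (x, y) c) = sW c (f x y)" for x y c
    by (simp add: F_def)
  have F_rel: "F p = 0" if "p \<in> bilinear_relations sA sB" for p
    using that unfolding bilinear_relations_def
    by (auto simp: FW.diff FW.scale F_single add1 add2 scale1 scale2)
  have F_span: "F p = 0" if "p \<in> F.span (bilinear_relations sA sB)" for p
    by (rule FW.eq_0_on_span[OF F_rel that])
  have F_eq: "F p = F q" if "proj p = proj q" for p q
  proof -
    have "proj (p - q) = 0" using that by (simp add: P.diff)
    then have "p - q \<in> F.span (bilinear_relations sA sB)" using kernel by blast
    then have "F (p - q) = 0" by (rule F_span)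
    then show ?thesis by (simp add: FW.diff)
  qed
  define h where "h z = F (SOME p. proj p = z)" for z
  have h_proj: "h (proj p) = F p" for p
    unfolding h_def by (rule F_eq, rule someI[of "\<lambda>q. proj q = proj p" p], rule refl)
  have lin: "Vector_Spaces.linear sT sW h"
  proof unfold_locales
    fix z z'
    obtain p q where pq: "z = proj p" "z' = proj q" using onto by (metis surjD)
    show "h (z + z') = h z + h z'"
      unfolding pq P.add[symmetric] h_proj by (rule FW.add)
  next
    fix c z
    obtain p where p: "z = proj p" using onto by (metis surjD)
    show "h (sT c z) = sW c (h z)"
      unfolding p P.scale[symmetric] h_proj by (rule FW.scale)
  qed
  have tens: "h (tens x y) = f x y" for x y
    using h_proj[of "Poly_Mapping.single (x, y) 1"] by (simp add: F_single)
  show ?thesis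
  proof (rule ex1I[of _ h])
    show "Vector_Spaces.linear sT sW h \<and> (\<forall>x y. h (tens x y) = f x y)"
      using lin tens by blast
  next
    fix g assume "Vector_Spaces.linear sT sW g \<and> (\<forall>x y. g (tens x y) = f x y)"
    then show "g = h" by (intro linear_unique[of sW]) (use lin tens in auto)
  qed
qed

end

lemma tensor_map:
  assumes "tensor_product sA sB sT tens" "tensor_product sC sD sU tens'"
    and f: "Vector_Spaces.linear sA sC f" and g: "Vector_Spaces.linear sB sD g"
  shows "Vector_Spaces.linear sT sU (tensor_map sT tens sU tens' f g)"
    and "tensor_map sT tens sU tens' f g (tens x y) = tens' (f x) (g y)"
proof -
  interpret T: tensor_product sA sB sT tens by fact
  interpret U: tensor_product sC sD sU tens' by fact
  interpret f: Vector_Spaces.linear sA sC f by fact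
  interpret g: Vector_Spaces.linear sB sD g by fact
  have "\<exists>!h. Vector_Spaces.linear sT sU h \<and> (\<forall>x y. h (tens x y) = tens' (f x) (g y))"
    by (rule T.universal_property)
       (simp_all add: U.T.vector_space_axioms f.add g.add f.scale g.scale U.bilinear)
  from theI'[OF this]
  show "Vector_Spaces.linear sT sU (tensor_map sT tens sU tens' f g)"
    and "tensor_map sT tens sU tens' f g (tens x y) = tens' (f x) (g y)"
    unfolding tensor_map_def by blast+
qed

text \<open>
  \<open>A\<^sup>\<otimes>\<^sup>2\<close> and \<open>A\<^sup>\<otimes>\<^sup>3\<close>. The single space \<open>A\<^sup>\<otimes>\<^sup>3\<close> is
  at the same time \<open>A \<otimes> (A \<otimes> A)\<close> (via \<open>tl\<close>) and \<open>(A \<otimes> A) \<otimes> A\<close>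
  (via \<open>tr\<close>), the assumption \<open>assoc\<close> being the usual identification of the two.
\<close>

locale tensor_powers =
  sq: tensor_product s s s2 t + left: tensor_product s s2 s3 tl +
  right: tensor_product s2 s s3 tr
  for s :: "'k::field_char_0 \<Rightarrow> 'a::ab_group_add \<Rightarrow> 'a"
    and s2 :: "'k \<Rightarrow> 'a2::ab_group_add \<Rightarrow> 'a2"
    and s3 :: "'k \<Rightarrow> 'a3::ab_group_add \<Rightarrow> 'a3"
    and t :: "'a \<Rightarrow> 'a \<Rightarrow> 'a2"
    and tl :: "'a \<Rightarrow> 'a2 \<Rightarrow> 'a3"
    and tr :: "'a2 \<Rightarrow> 'a \<Rightarrow> 'a3" +
  assumes assoc: "tl x (t y z) = tr (t x y) z"
begin

text \<open>
  \<open>f \<otimes> g\<close> for maps \<open>A\<^sup>\<otimes>\<^sup>i \<rightarrow> A\<^sup>\<otimes>\<^sup>j\<close>; the numerals give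
  \<open>i\<close> and \<open>j\<close> for the left and then for the right factor.
\<close>

abbreviation map11_11 :: "('a \<Rightarrow> 'a) \<Rightarrow> ('a \<Rightarrow> 'a) \<Rightarrow> 'a2 \<Rightarrow> 'a2" where
  "map11_11 \<equiv> tensor_map s2 t s2 t"

abbreviation map11_21 :: "('a \<Rightarrow> 'a) \<Rightarrow> ('a2 \<Rightarrow> 'a) \<Rightarrow> 'a3 \<Rightarrow> 'a2" where
  "map11_21 \<equiv> tensor_map s3 tl s2 t"

abbreviation map21_11 :: "('a2 \<Rightarrow> 'a) \<Rightarrow> ('a \<Rightarrow> 'a) \<Rightarrow> 'a3 \<Rightarrow> 'a2" where
  "map21_11 \<equiv> tensor_map s3 tr s2 t"

abbreviation map11_12 :: "('a \<Rightarrow> 'a) \<Rightarrow> ('a \<Rightarrow> 'a2) \<Rightarrow> 'a2 \<Rightarrow> 'a3" where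
  "map11_12 \<equiv> tensor_map s2 t s3 tl"

abbreviation map12_11 :: "('a \<Rightarrow> 'a2) \<Rightarrow> ('a \<Rightarrow> 'a) \<Rightarrow> 'a2 \<Rightarrow> 'a3" where
  "map12_11 \<equiv> tensor_map s2 t s3 tr"

text \<open>
  The bracket \<open>[a, r]\<^sub>*\<close>, written without choosing a decomposition of \<open>r\<close>; the lemma
  \<open>bracket_sum\<close> gives its value on \<open>r = \<Sum> u\<^sub>i \<otimes> v\<^sub>i\<close>.
\<close>

definition bracket :: "('a2 \<Rightarrow> 'a) \<Rightarrow> ('a \<Rightarrow> 'a) \<Rightarrow> 'a \<Rightarrow> 'a2 \<Rightarrow> 'a2" where
  "bracket mu alpha a r =
     map11_11 (\<lambda>u. mu (t a u)) alpha r - map11_11 alpha (\<lambda>v. mu (t v a)) r"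

lemma bracket_sum:
  assumes mu: "Vector_Spaces.linear s2 s mu" and alpha: "Vector_Spaces.linear s s alpha"
  shows "bracket mu alpha a (\<Sum>i\<in>I. t (u i) (v i)) =
    (\<Sum>i\<in>I. t (mu (t a (u i))) (alpha (v i)) - t (alpha (u i)) (mu (t (v i) a)))"
proof -
  interpret mu: Vector_Spaces.linear s2 s mu by fact
  note sq = sq.tensor_product_axioms
  have L: "Vector_Spaces.linear s s (\<lambda>u. mu (t a u))"
    by unfold_locales (simp_all add: sq.bilinear mu.add mu.scale)
  have R: "Vector_Spaces.linear s s (\<lambda>v. mu (t v a))"
    by unfold_locales (simp_all add: sq.bilinear mu.add mu.scale)
  interpret M: Vector_Spaces.linear s2 s2 "map11_11 (\<lambda>u. mu (t a u)) alpha"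
    by (rule tensor_map(1)[OF sq sq L alpha])
  interpret N: Vector_Spaces.linear s2 s2 "map11_11 alpha (\<lambda>v. mu (t v a))"
    by (rule tensor_map(1)[OF sq sq alpha R])
  show ?thesis
    by (simp add: bracket_def M.sum N.sum sum_subtractf
        tensor_map(2)[OF sq sq L alpha] tensor_map(2)[OF sq sq alpha R])
qed

end

locale eps_hom_bialgebra = tensor_powers s s2 s3 t tl tr
  for s :: "'k::field_char_0 \<Rightarrow> 'a::ab_group_add \<Rightarrow> 'a"
    and s2 :: "'k \<Rightarrow> 'a2::ab_group_add \<Rightarrow> 'a2"
    and s3 :: "'k \<Rightarrow> 'a3::ab_group_add \<Rightarrow> 'a3"
    and t tl tr +
  fixes mu :: "'a2 \<Rightarrow> 'a" and Delta :: "'a \<Rightarrow> 'a2" and alpha :: "'a \<Rightarrow> 'a"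
  assumes linear_mu: "Vector_Spaces.linear s2 s mu"
    and linear_Delta: "Vector_Spaces.linear s s2 Delta"
    and linear_alpha: "Vector_Spaces.linear s s alpha"
    and mult: "alpha \<circ> mu = mu \<circ> map11_11 alpha alpha"
    and hom_assoc: "mu \<circ> map11_21 alpha mu = mu \<circ> map21_11 mu alpha"
    and comult: "map11_11 alpha alpha \<circ> Delta = Delta \<circ> alpha"
    and hom_coassoc: "map11_12 alpha Delta \<circ> Delta = map12_11 Delta alpha \<circ> Delta"
    and compat: "Delta \<circ> mu =
      (\<lambda>z. (map21_11 mu alpha \<circ> map11_12 alpha Delta) z
         + (map11_21 alpha mu \<circ> map12_11 Delta alpha) z)"

locale coboundary_eps_hom_bialgebra =
  eps_hom_bialgebra s s2 s3 t tl tr mu Delta alpha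
  for s :: "'k::field_char_0 \<Rightarrow> 'a::ab_group_add \<Rightarrow> 'a"
    and s2 :: "'k \<Rightarrow> 'a2::ab_group_add \<Rightarrow> 'a2"
    and s3 :: "'k \<Rightarrow> 'a3::ab_group_add \<Rightarrow> 'a3"
    and t tl tr mu Delta alpha +
  fixes r :: 'a2
  assumes invariant: "map11_11 alpha alpha r = r"
    and coboundary: "Delta = (\<lambda>a. bracket mu alpha a r)"

end

theory Submission
  imports Defs
begin

text \<open>
  This is Yau's twisting principle: if \<open>b\<close> is an endomorphism of a coboundary
  \<open>\<epsilon>\<close>-Hom-bialgebra fixing \<open>r\<close>, then replacing \<open>(\<mu>, \<Delta>, \<alpha>)\<close> by
  \<open>(b \<circ> \<mu>, \<Delta> \<circ> b, b \<circ> \<alpha>)\<close> composes both sides of every axiom with the same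
  powers of \<open>b\<close> or \<open>b \<otimes> b\<close>. Every power of \<open>\<alpha>\<close> is such an endomorphism; take
  \<open>b = \<alpha> ^ (2 ^ n - 1)\<close>.
\<close>

text \<open>Both sides are linear and send \<open>tens x y\<close> to
  \<open>tens'' (f' (f x)) (g' (g y))\<close>, and a linear map on a tensor product is determined by
  its values on pure tensors.\<close>

lemma tensor_map_comp:
  assumes T: "tensor_product sA sB sT tens" and U: "tensor_product sC sD sU tens'"
    and V: "tensor_product sE sF sV tens''"
    and f: "Vector_Spaces.linear sA sC f" and g: "Vector_Spaces.linear sB sD g"
    and f': "Vector_Spaces.linear sC sE f'" and g': "Vector_Spaces.linear sD sF g'"
  shows "tensor_map sT tens sV tens'' (f' \<circ> f) (g' \<circ> g) =
    tensor_map sU tens' sV tens'' f' g' \<circ> tensor_map sT tens sU tens' f g"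
proof -
  have f'f: "Vector_Spaces.linear sA sE (f' \<circ> f)" and g'g: "Vector_Spaces.linear sB sF (g' \<circ> g)"
    using f g f' g' by (auto intro: Vector_Spaces.linear_compose)
  show ?thesis
    by (rule tensor_product.linear_unique[OF T tensor_map(1)[OF T V f'f g'g]
          Vector_Spaces.linear_compose[OF tensor_map(1)[OF T U f g] tensor_map(1)[OF U V f' g']]])
       (simp add: tensor_map(2)[OF T V f'f g'g] tensor_map(2)[OF T U f g]
          tensor_map(2)[OF U V f' g'])
qed

locale coboundary_endomorphism =
  coboundary_eps_hom_bialgebra s s2 s3 t tl tr mu Delta alpha r
  for s :: "'k::field_char_0 \<Rightarrow> 'a::ab_group_add \<Rightarrow> 'a"
    and s2 :: "'k \<Rightarrow> 'a2::ab_group_add \<Rightarrow> 'a2"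
    and s3 :: "'k \<Rightarrow> 'a3::ab_group_add \<Rightarrow> 'a3"
    and t tl tr mu Delta alpha r +
  fixes b :: "'a \<Rightarrow> 'a"
  assumes linear_b: "Vector_Spaces.linear s s b"
    and b_alpha: "b \<circ> alpha = alpha \<circ> b"
    and b_mu: "b \<circ> mu = mu \<circ> map11_11 b b"
    and b_Delta: "map11_11 b b \<circ> Delta = Delta \<circ> b"
    and b_invariant: "map11_11 b b r = r"
begin

lemmas sq_tp = sq.tensor_product_axioms
lemmas left_tp = left.tensor_product_axioms
lemmas right_tp = right.tensor_product_axioms
lemmas linears = linear_mu linear_Delta linear_alpha linear_b

text \<open>Factors of \<open>b\<close> are pulled out on the output side for \<open>mu\<close> and
  on the input side for \<open>Delta\<close>, using \<open>b_alpha\<close> in the second case. So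
  only \<open>b\<close> tensor \<open>b\<close> on the square occurs, never a triple tensor of
  \<open>b\<close>.\<close>

lemma map_twists:
  "map11_11 (b \<circ> alpha) (b \<circ> alpha) = map11_11 b b \<circ> map11_11 alpha alpha"
  "map11_21 (b \<circ> alpha) (b \<circ> mu) = map11_11 b b \<circ> map11_21 alpha mu"
  "map21_11 (b \<circ> mu) (b \<circ> alpha) = map11_11 b b \<circ> map21_11 mu alpha"
  "map11_12 (b \<circ> alpha) (Delta \<circ> b) = map11_12 alpha Delta \<circ> map11_11 b b"
  "map12_11 (Delta \<circ> b) (b \<circ> alpha) = map12_11 Delta alpha \<circ> map11_11 b b"
proof -
  show "map11_11 (b \<circ> alpha) (b \<circ> alpha) = map11_11 b b \<circ> map11_11 alpha alpha"
    by (rule tensor_map_comp[OF sq_tp sq_tp sq_tp]) (rule linears)+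
  show "map11_21 (b \<circ> alpha) (b \<circ> mu) = map11_11 b b \<circ> map11_21 alpha mu"
    by (rule tensor_map_comp[OF left_tp sq_tp sq_tp]) (rule linears)+
  show "map21_11 (b \<circ> mu) (b \<circ> alpha) = map11_11 b b \<circ> map21_11 mu alpha"
    by (rule tensor_map_comp[OF right_tp sq_tp sq_tp]) (rule linears)+
  show "map11_12 (b \<circ> alpha) (Delta \<circ> b) = map11_12 alpha Delta \<circ> map11_11 b b"
    unfolding b_alpha by (rule tensor_map_comp[OF sq_tp sq_tp left_tp]) (rule linears)+
  show "map12_11 (Delta \<circ> b) (b \<circ> alpha) = map12_11 Delta alpha \<circ> map11_11 b b"
    unfolding b_alpha by (rule tensor_map_comp[OF sq_tp sq_tp right_tp]) (rule linears)+
qed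

text \<open>In each of the two terms of the bracket, \<open>b\<close> is composed after both tensor
  factors, so functoriality and linearity pull it out.\<close>

lemma bracket_twist:
  "bracket (b \<circ> mu) (b \<circ> alpha) a z = map11_11 b b (bracket mu alpha a z)"
proof -
  interpret mu: Vector_Spaces.linear s2 s mu by (rule linear_mu)
  have L: "Vector_Spaces.linear s s (\<lambda>u. mu (t a u))"
    by unfold_locales (simp_all add: sq.bilinear mu.add mu.scale)
  have R: "Vector_Spaces.linear s s (\<lambda>v. mu (t v a))"
    by unfold_locales (simp_all add: sq.bilinear mu.add mu.scale)
  interpret B: Vector_Spaces.linear s2 s2 "map11_11 b b"
    by (rule tensor_map(1)[OF sq_tp sq_tp linear_b linear_b])
  show ?thesis
    using tensor_map_comp[OF sq_tp sq_tp sq_tp L linear_alpha linear_b linear_b]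
      tensor_map_comp[OF sq_tp sq_tp sq_tp linear_alpha R linear_b linear_b]
    by (simp add: bracket_def B.diff comp_def)
qed

theorem twist:
  "coboundary_eps_hom_bialgebra s s2 s3 t tl tr (b \<circ> mu) (Delta \<circ> b) (b \<circ> alpha) r"
proof -
  interpret B: Vector_Spaces.linear s2 s2 "map11_11 b b"
    by (rule tensor_map(1)[OF sq_tp sq_tp linear_b linear_b])
  \<comment> \<open>Oriented this way, the rules move \<open>b\<close> and \<open>alpha\<close>
    through \<open>mu\<close> and \<open>Delta\<close> toward the argument.\<close>
  note [simp] = fun_cong[OF b_alpha, unfolded comp_apply] fun_cong[OF b_mu, unfolded comp_apply]
    fun_cong[OF mult, unfolded comp_apply]
    fun_cong[OF b_Delta, unfolded comp_apply] fun_cong[OF comult, unfolded comp_apply]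
    fun_cong[OF hom_coassoc, unfolded comp_apply]
  have ba: "map11_11 b b (map11_11 alpha alpha z) = map11_11 alpha alpha (map11_11 b b z)" for z
    using tensor_map_comp[OF sq_tp sq_tp sq_tp linear_alpha linear_alpha linear_b linear_b]
      tensor_map_comp[OF sq_tp sq_tp sq_tp linear_b linear_b linear_alpha linear_alpha]
    by (metis b_alpha comp_apply)
  show ?thesis
  proof (intro coboundary_eps_hom_bialgebra.intro eps_hom_bialgebra.intro
      eps_hom_bialgebra_axioms.intro coboundary_eps_hom_bialgebra_axioms.intro)
    show "tensor_powers s s2 s3 t tl tr" by (rule tensor_powers_axioms)
    show "Vector_Spaces.linear s2 s (b \<circ> mu)" "Vector_Spaces.linear s s2 (Delta \<circ> b)"
      "Vector_Spaces.linear s s (b \<circ> alpha)"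
      using linears by (auto intro: Vector_Spaces.linear_compose)
    show "b \<circ> alpha \<circ> (b \<circ> mu) = b \<circ> mu \<circ> map11_11 (b \<circ> alpha) (b \<circ> alpha)"
      unfolding map_twists by (rule ext) (simp add: ba)
    \<comment> \<open>Reading \<open>b_mu\<close> from right to left turns both sides into
      \<open>b\<close> applied twice to the two sides of \<open>hom_assoc\<close>.\<close>
    show "b \<circ> mu \<circ> map11_21 (b \<circ> alpha) (b \<circ> mu) = b \<circ> mu \<circ> map21_11 (b \<circ> mu) (b \<circ> alpha)"
      unfolding map_twists by (rule ext)
        (simp only: comp_apply fun_cong[OF b_mu, unfolded comp_apply, symmetric]
          fun_cong[OF hom_assoc, unfolded comp_apply])
    show "map11_11 (b \<circ> alpha) (b \<circ> alpha) \<circ> (Delta \<circ> b) = Delta \<circ> b \<circ> (b \<circ> alpha)"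
      unfolding map_twists by (rule ext) simp
    \<comment> \<open>Dually, both sides become those of \<open>hom_coassoc\<close> evaluated at
      \<open>b (b x)\<close>.\<close>
    show "map11_12 (b \<circ> alpha) (Delta \<circ> b) \<circ> (Delta \<circ> b) =
        map12_11 (Delta \<circ> b) (b \<circ> alpha) \<circ> (Delta \<circ> b)"
      unfolding map_twists by (rule ext) simp
    show "Delta \<circ> b \<circ> (b \<circ> mu) = (\<lambda>z.
        (map21_11 (b \<circ> mu) (b \<circ> alpha) \<circ> map11_12 (b \<circ> alpha) (Delta \<circ> b)) z +
        (map11_21 (b \<circ> alpha) (b \<circ> mu) \<circ> map12_11 (Delta \<circ> b) (b \<circ> alpha)) z)"
    proof
      fix z
      \<comment> \<open>One \<open>b\<close> leaves through \<open>Delta\<close> and the other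
        enters through \<open>mu\<close>. What remains in between is \<open>compat\<close> at
        \<open>map11_11 b b z\<close>. Below, \<open>b_Delta\<close> is switched off so that the
        outer \<open>map11_11 b b\<close> stays in place and distributes over the sum.\<close>
      have "(Delta \<circ> b \<circ> (b \<circ> mu)) z = map11_11 b b (Delta (mu (map11_11 b b z)))" by simp
      then show "(Delta \<circ> b \<circ> (b \<circ> mu)) z =
        (map21_11 (b \<circ> mu) (b \<circ> alpha) \<circ> map11_12 (b \<circ> alpha) (Delta \<circ> b)) z +
        (map11_21 (b \<circ> alpha) (b \<circ> mu) \<circ> map12_11 (Delta \<circ> b) (b \<circ> alpha)) z"
        using fun_cong[OF compat, of "map11_11 b b z"]
        unfolding map_twists by (simp add: B.add del: fun_cong[OF b_Delta, unfolded comp_apply])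
    qed
    show "map11_11 (b \<circ> alpha) (b \<circ> alpha) r = r"
      by (simp add: map_twists invariant b_invariant)
    show "Delta \<circ> b = (\<lambda>a. bracket (b \<circ> mu) (b \<circ> alpha) a r)"
      unfolding bracket_twist using b_Delta coboundary by (auto simp: fun_eq_iff)
  qed
qed

end

text \<open>Since the tensor square of \<open>alpha ^^ m\<close> is the m-th iterate of that of
  \<open>alpha\<close>, each condition follows by iterating the corresponding axiom for
  \<open>alpha\<close>.\<close>

lemma (in coboundary_eps_hom_bialgebra) coboundary_endomorphism_power:
  "coboundary_endomorphism s s2 s3 t tl tr mu Delta alpha r (alpha ^^ m)"
proof -
  note sq = sq.tensor_product_axioms
  have lin: "Vector_Spaces.linear s s (alpha ^^ m)" for m
  proof (induction m)
    case 0
    show ?case using sq.A.linear_id by (simp add: id_def)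
  next
    case (Suc m)
    then show ?case using Vector_Spaces.linear_compose[OF Suc linear_alpha] by (simp add: comp_def)
  qed
  have pow: "map11_11 (alpha ^^ m) (alpha ^^ m) = map11_11 alpha alpha ^^ m" for m
  proof (induction m)
    case 0
    \<comment> \<open>The zeros in \<open>of 0 0\<close> are the exponents of \<open>alpha\<close>;
      the vectors stay arbitrary.\<close>
    show ?case
      by (rule sq.linear_unique[OF tensor_map(1)[OF sq sq lin lin]])
         (use sq.T.linear_id tensor_map(2)[OF sq sq lin lin, of 0 0] in \<open>simp_all add: id_def\<close>)
  next
    case (Suc m)
    then show ?case
      using tensor_map_comp[OF sq sq sq lin[of m] lin[of m] linear_alpha linear_alpha]
      by (simp add: comp_def)
  qed
  have mu_pow: "(alpha ^^ m) (mu z) = mu ((map11_11 alpha alpha ^^ m) z)" for z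
    by (induction m) (use fun_cong[OF mult] in auto)
  have Delta_pow: "(map11_11 alpha alpha ^^ m) (Delta x) = Delta ((alpha ^^ m) x)" for x
    by (induction m) (use fun_cong[OF comult] in auto)
  have r_pow: "(map11_11 alpha alpha ^^ m) r = r"
    by (induction m) (use invariant in auto)
  show ?thesis
    by (intro coboundary_endomorphism.intro coboundary_endomorphism_axioms.intro
        coboundary_eps_hom_bialgebra_axioms)
      (auto simp: lin pow mu_pow Delta_pow r_pow funpow_swap1 fun_eq_iff)
qed

theorem theorem3p3:
  fixes s :: "'k::field_char_0 \<Rightarrow> 'a::ab_group_add \<Rightarrow> 'a"
    and s2 :: "'k \<Rightarrow> 'a2::ab_group_add \<Rightarrow> 'a2"
    and s3 :: "'k \<Rightarrow> 'a3::ab_group_add \<Rightarrow> 'a3"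
    and t :: "'a \<Rightarrow> 'a \<Rightarrow> 'a2"
    and tl :: "'a \<Rightarrow> 'a2 \<Rightarrow> 'a3"
    and tr :: "'a2 \<Rightarrow> 'a \<Rightarrow> 'a3"
    and mu :: "'a2 \<Rightarrow> 'a" and Delta :: "'a \<Rightarrow> 'a2" and alpha :: "'a \<Rightarrow> 'a"
    and r :: 'a2 and n :: nat
  assumes "coboundary_eps_hom_bialgebra s s2 s3 t tl tr mu Delta alpha r"
  shows "coboundary_eps_hom_bialgebra s s2 s3 t tl tr
           ((alpha ^^ (2 ^ n - 1)) \<circ> mu) (Delta \<circ> (alpha ^^ (2 ^ n - 1))) (alpha ^^ (2 ^ n)) r"
proof -
  interpret coboundary_eps_hom_bialgebra s s2 s3 t tl tr mu Delta alpha r by fact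
  \<comment> \<open>The twist map becomes \<open>b \<circ> alpha\<close>, which supplies the missing
    factor; the natural subtraction is exact because \<open>2 ^ n\<close> is at least 1.\<close>
  have "alpha ^^ (2 ^ n - 1) \<circ> alpha = alpha ^^ (2 ^ n)"
    using funpow_Suc_right[of "2 ^ n - 1" alpha] by simp
  then show ?thesis
    using coboundary_endomorphism.twist[OF coboundary_endomorphism_power[of "2 ^ n - 1"]] by simp
qed

end
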